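(* Let $\partial\mathcal D\subset\mathbb R^2$ be a simple polygon and assume there is an order-preserving bijection $v\mapsto\bm p_v$ from $V(N)$ to the vertex set $V(\partial\mathcal D)$. Assume further that there is a continuous piecewise linear function $\mathfrak h_0:\partial\mathcal D\to\mathbb R$ such that, for all $v\in V(N)$, $$\mathfrak h_0(x,y)=(x,y)\cdot(s^v,t^v)-d_v$$ along the two line segments of $\partial\mathcal D$ adjacent to $\bm p_v$, for some constant $d_v$. Then the enclosed region $\mathcal D$ is an astroidal domain $\mathcal D_c$ with $$c(e)=\frac{d_{v_+}-d_{v_-}}{|e|_{\mathbb Z}}\qquad\text{for }e=[v_-,v_+]\in E(N).$$
   Context: **Polygon.** $N\subset\mathbb R^2$ is a convex lattice polygon, $\partial N$ oriented counterclockwise; $V(N)$ is the set of corners and $E(N)$ the set of (full) sides, oriented along $\partial N$, with displacement vectors $\vec e$. $|e|_{\mathbb Z}=|e\cap\mathbb Z^2|-1$, $(a_e,b_e)=\vec e/|e|_{\mathbb Z}$. Write $e=[v_-,v_+]$ with $v_-$ the clockwise and $v_+$ the counterclockwise endpoint, and $v=e_-\cap e_+$ with $e_-$ ($e_+$) the side immediately clockwise (counterclockwise) from $v$. $N^\perp$ is the polygon obtained (up to translation) by rotating $N$ by $-\pi/2$, and $(s^v,t^v)\in V(N^\perp)$ is the vertex corresponding to $v\in V(N)$; thus $(s^{v_+}-s^{v_-},t^{v_+}-t^{v_-})=|e|_{\mathbb Z}(b_e,-a_e)$ for $e=[v_-,v_+]$. **Order-preserving** means that vertices consecutive along $\partial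 N$ are sent to vertices consecutive along $\partial\mathcal D$; it is assumed neither that the sides of $\partial\mathcal D$ are parallel to those of $N$ nor that the map reverses (or preserves) orientation. **Astroidal domain.** For $c:E(N)\to\mathbb R$ let $\bm l_e=\{(x,y):-b_ex+a_ey+c(e)=0\}$ and, for $v=e_-\cap e_+$, $\bm p_v=\bm l_{e_-}\cap\bm l_{e_+}$. $\partial\mathcal D_c$ is the closed polygonal path visiting the points $\bm p_v$ in the clockwise cyclic order of $v\in V(N)$, going from $\bm p_{v_+}$ to $\bm p_{v_-}$ along $\bm l_e$ for $e=[v_-,v_+]$. If $\partial\mathcal D_c$ is a simple cycle, traversed counterclockwise, and $c$ is admissible, $\sum_{e\in E(N)}|e|_{\mathbb Z}c(e)=0$, then the closed region $\mathcal D_c$ bounded by $\partial\mathcal D_c$ is called an astroidal domain. In this statement the points $\bm p_v$ are pairwise distinct. *)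

theory Defs
  imports "HOL-Complex_Analysis.Complex_Analysis"
begin

(* The plane is identified with complex: (x,y) is x + i*y, and the dot product of the
   plane is the library's inner product on complex. *)

definition lattice :: "complex set" where
  "lattice = {z. Re z \<in> \<int> \<and> Im z \<in> \<int>}"

definition convex_lattice_polygon :: "complex set \<Rightarrow> bool" where
  "convex_lattice_polygon N \<longleftrightarrow>
     (\<exists>S. finite S \<and> S \<subseteq> lattice \<and> N = convex hull S) \<and> interior N \<noteq> {}"

definition corners :: "complex set \<Rightarrow> complex set" where
  "corners N = {v. v extreme_point_of N}"

(* A side e = [v_-, v_+] is the pair (v_-, v_+).  Since Im (cnj a * b) is the determinant of
   (a, b), the second condition puts N to the left of the side: the orientation is
   counterclockwise.  *)
definition sides :: "complex set \<Rightarrow> (complex \<times> complex) set" where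
  "sides N = {(u, w). closed_segment u w edge_of N \<and> (\<forall>z\<in>N. 0 \<le> Im (cnj (w - u) * (z - u)))}"

definition lattice_length :: "complex \<times> complex \<Rightarrow> real" where
  "lattice_length e = real (card (closed_segment (fst e) (snd e) \<inter> lattice)) - 1"

(* primitive e = a_e + i*b_e *)
definition primitive :: "complex \<times> complex \<Rightarrow> complex" where
  "primitive e = (snd e - fst e) / complex_of_real (lattice_length e)"

(* The corner (s^v, t^v) of the polygon N rotated by -pi/2 and then translated by tau. *)
definition dual_vertex :: "complex \<Rightarrow> complex \<Rightarrow> complex" where
  "dual_vertex \<tau> v = - \<i> * v + \<tau>"

fun polygonal_path :: "complex list \<Rightarrow> real \<Rightarrow> complex" where
  "polygonal_path [] = linepath 0 0"
| "polygonal_path [a] = linepath a a"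
| "polygonal_path [a, b] = linepath a b"
| "polygonal_path (a # b # c # ps) = linepath a b +++ polygonal_path (b # c # ps)"

definition closed_polygon :: "complex list \<Rightarrow> real \<Rightarrow> complex" where
  "closed_polygon ps = polygonal_path (ps @ [hd ps])"

(* The list is the cyclic sequence of vertices.  Straight angles are not excluded. *)
definition simple_polygon :: "complex list \<Rightarrow> bool" where
  "simple_polygon ps \<longleftrightarrow> length ps \<ge> 3 \<and> simple_path (closed_polygon ps)"

definition boundary :: "complex list \<Rightarrow> complex set" where
  "boundary ps = path_image (closed_polygon ps)"

definition enclosed_region :: "complex list \<Rightarrow> complex set" where
  "enclosed_region ps = boundary ps \<union> inside (boundary ps)"

definition consecutive :: "complex list \<Rightarrow> complex \<Rightarrow> complex \<Rightarrow> bool" where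
  "consecutive ps a b \<longleftrightarrow>
     (\<exists>i<length ps. {a, b} = {ps ! i, ps ! (Suc i mod length ps)})"

definition order_preserving :: "complex set \<Rightarrow> complex list \<Rightarrow> (complex \<Rightarrow> complex) \<Rightarrow> bool" where
  "order_preserving N ps p \<longleftrightarrow> (\<forall>(u, w)\<in>sides N. consecutive ps (p u) (p w))"

(* Used only for one-dimensional S: on each of finitely many segments covering S,
   f is the restriction of an affine function. *)
definition piecewise_linear_on :: "complex set \<Rightarrow> (complex \<Rightarrow> real) \<Rightarrow> bool" where
  "piecewise_linear_on S f \<longleftrightarrow>
     (\<exists>F. finite F \<and> S = (\<Union>(a, b)\<in>F. closed_segment a b) \<and>
        (\<forall>(a, b)\<in>F. \<exists>g k. \<forall>z\<in>closed_segment a b. f z = z \<bullet> g + k))"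

definition side_line :: "(complex \<times> complex \<Rightarrow> real) \<Rightarrow> complex \<times> complex \<Rightarrow> complex set" where
  "side_line c e =
     {z. - Im (primitive e) * Re z + Re (primitive e) * Im z + c e = 0}"

(* e_- and e_+ *)
definition side_before :: "complex set \<Rightarrow> complex \<Rightarrow> complex \<times> complex" where
  "side_before N v = (THE e. e \<in> sides N \<and> snd e = v)"

definition side_after :: "complex set \<Rightarrow> complex \<Rightarrow> complex \<times> complex" where
  "side_after N v = (THE e. e \<in> sides N \<and> fst e = v)"

definition astroidal_vertex ::
    "complex set \<Rightarrow> (complex \<times> complex \<Rightarrow> real) \<Rightarrow> complex \<Rightarrow> complex" where
  "astroidal_vertex N c v =
     the_elem (side_line c (side_before N v) \<inter> side_line c (side_after N v))"

definition admissible :: "complex set \<Rightarrow> (complex \<times> complex \<Rightarrow> real) \<Rightarrow> bool" where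
  "admissible N c \<longleftrightarrow> (\<Sum>e\<in>sides N. lattice_length e * c e) = 0"

definition clockwise_corners :: "complex set \<Rightarrow> complex list \<Rightarrow> bool" where
  "clockwise_corners N vs \<longleftrightarrow> distinct vs \<and> set vs = corners N \<and>
     (\<forall>i<length vs. (vs ! (Suc i mod length vs), vs ! i) \<in> sides N)"

(* D is the region D_c.  The choice of vs is only the choice of a first corner. *)
definition astroidal_domain ::
    "complex set \<Rightarrow> (complex \<times> complex \<Rightarrow> real) \<Rightarrow> complex set \<Rightarrow> bool" where
  "astroidal_domain N c D \<longleftrightarrow> admissible N c \<and>
     (\<exists>vs qs. clockwise_corners N vs \<and> qs = map (astroidal_vertex N c) vs \<and>
        simple_polygon qs \<and>
        (\<forall>z\<in>inside (boundary qs). winding_number (closed_polygon qs) z = 1) \<and>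
        D = enclosed_region qs)"

end

theory Submission
  imports Defs
begin

text \<open>
  On the segment from \<open>p u\<close> to \<open>p w\<close> belonging to a side \<open>(u, w)\<close> the two affine formulas for
  \<open>h\<^sub>0\<close> agree, and their difference is the equation of the line of the side; hence \<open>p v\<close> is the
  astroidal vertex.  The constants \<open>|e| c(e)\<close> are differences of \<open>d\<close>, so they telescope to zero.

  The orientation needs an argument.  Let \<open>z\<close> be a point inside and write the polygon, visited
  clockwise with respect to \<open>N\<close>, relative to \<open>z\<close> and to the frame given by the side of \<open>N\<close>.  In
  this frame the point moves parallel to the real axis along an edge and rotates counterclockwise
  about the origin at a vertex.  So it can cross the real axis only counterclockwise, and since
  the frame makes one clockwise turn, the winding number around \<open>z\<close> is \<open>- 1\<close> plus the number of
  turns in the frame.  Admissibility, which is invariant under translation, says that a weighted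
  sum of the signed distances from the real axis vanishes; hence both signs occur, there is at least one
  turn, and the winding number is not \<open>- 1\<close>.
\<close>

section \<open>Sums of arguments\<close>

text \<open>Two points at the same height lie in the same open half-plane or, since the quotient is
  not negative, on the same real ray. So the difference of their arguments stays in the range of
  \<open>Arg\<close>. This is the case of motion along an edge.\<close>

lemma Arg_divide_not_nonpos:
  assumes "Im a = Im b" "a \<noteq> 0" "b \<noteq> 0" "b / a \<notin> \<real>\<^sub>\<le>\<^sub>0"
  shows "Arg (b / a) = Arg b - Arg a"
proof -
  have "- pi < Arg b - Arg a \<and> Arg b - Arg a \<le> pi"
  proof (cases "Im a = 0")
    case True
    then obtain x y where xy: "a = of_real x" "b = of_real y"
      using assms(1) by (metis complex_is_Real_iff Reals_cases)
    have "0 < y / x"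
      using assms(4) unfolding xy of_real_divide [symmetric] nonpos_Reals_of_real_iff by simp
    then show ?thesis
      using xy by (auto simp: Arg_of_real zero_less_divide_iff)
  next
    case False
    then consider "0 < Im a" "0 < Im b" | "Im a < 0" "Im b < 0"
      using assms(1) by linarith
    then show ?thesis
      using Arg_lt_pi [of a] Arg_lt_pi [of b] Arg_neg_iff [of a] Arg_neg_iff [of b]
        mpi_less_Arg [of a] mpi_less_Arg [of b] by cases force+
  qed
  moreover have "b / a = rcis (norm b / norm a) (Arg b - Arg a)"
    using assms(2,3) by (metis rcis_cmod_Arg rcis_divide)
  ultimately show ?thesis
    using assms(2,3) by (intro Arg_unique' [of "norm b / norm a"]) auto
qed

text \<open>The correction records the crossings of the cut of \<^const>\<open>Arg\<close>.\<close>

lemma Arg_divide_ccw: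
  assumes "0 < Im (b / a)"
  shows "Arg (b / a) = Arg b - Arg a + (if 0 \<le> Im a \<and> Im b < 0 then 2 * pi else 0)"
proof -
  have nz: "a \<noteq> 0" "b \<noteq> 0"
    using assms by auto
  define \<theta> where "\<theta> = Arg b - Arg a"
  have eq: "b / a = rcis (norm b / norm a) \<theta>"
    unfolding \<theta>_def using nz by (metis rcis_cmod_Arg rcis_divide)
  have "Im (b / a) = norm b / norm a * sin \<theta>"
    unfolding eq by (rule Im_rcis)
  with assms have sin: "0 < sin \<theta>"
    using nz by (metis divide_pos_pos zero_less_mult_pos zero_less_norm_iff)
  have bounds: "- (2 * pi) < \<theta>" "\<theta> < 2 * pi"
    using mpi_less_Arg [of a] mpi_less_Arg [of b] Arg_le_pi [of a] Arg_le_pi [of b]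
    unfolding \<theta>_def by linarith+
  \<comment> \<open>Positivity of the sine leaves two intervals, and the negative one is the passage
    through the cut. \<open>Arg\<close> equals \<open>pi\<close> on the negative real axis, so the
    axis belongs to the upper side: hence \<open>0 \<le> Im a\<close> but
    \<open>Im b < 0\<close>.\<close>
  consider (pos) "0 < \<theta>" "\<theta> < pi" | (neg) "- (2 * pi) < \<theta>" "\<theta> < - pi"
  proof -
    have "\<not> (pi \<le> \<theta>)"
      using sin_ge_zero [of "\<theta> - pi"] bounds sin by auto
    moreover have "\<not> (- pi \<le> \<theta> \<and> \<theta> \<le> 0)"
      using sin_ge_zero [of "- \<theta>"] sin by auto
    ultimately show thesis
      using that bounds by linarith
  qed
  then show ?thesis
  proof cases
    case pos
    have "Arg (b / a) = \<theta>"
      by (rule Arg_unique' [OF _ _ eq]) (use pos nz in auto)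
    moreover have "\<not> (0 \<le> Im a \<and> Im b < 0)"
      using pos Arg_less_0 [of a] Arg_neg_iff [of b] unfolding \<theta>_def by linarith
    ultimately show ?thesis
      unfolding \<theta>_def by simp
  next
    case neg
    have "b / a = rcis (norm b / norm a) (\<theta> + 2 * pi)"
      unfolding eq rcis_def by (simp add: complex_eq_iff)
    then have "Arg (b / a) = \<theta> + 2 * pi"
      by (rule Arg_unique' [rotated 2]) (use neg nz in auto)
    moreover have "0 \<le> Im a \<and> Im b < 0"
      using neg Arg_less_0 [of a] Arg_neg_iff [of b] mpi_less_Arg [of b] Arg_le_pi [of a]
      unfolding \<theta>_def by linarith
    ultimately show ?thesis
      unfolding \<theta>_def by simp
  qed
qed

lemma sum_Arg_ccw:
  fixes a b :: "nat \<Rightarrow> complex"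
  assumes "\<And>i. i < n \<Longrightarrow> 0 < Im (b i / a i)"
  shows "(\<Sum>i<n. Arg (b i / a i)) = (\<Sum>i<n. Arg (b i) - Arg (a i))
     + 2 * pi * card {i \<in> {..<n}. 0 \<le> Im (a i) \<and> Im (b i) < 0}"
proof -
  have "(\<Sum>i<n. Arg (b i / a i)) =
      (\<Sum>i<n. Arg (b i) - Arg (a i) + (if 0 \<le> Im (a i) \<and> Im (b i) < 0 then 2 * pi else 0))"
    by (rule sum.cong) (use assms Arg_divide_ccw in auto)
  also have "\<dots> = (\<Sum>i<n. Arg (b i) - Arg (a i))
      + (\<Sum>i\<in>{i \<in> {..<n}. 0 \<le> Im (a i) \<and> Im (b i) < 0}. 2 * pi)"
    unfolding sum.distrib by (subst sum.inter_filter) auto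
  finally show ?thesis
    by simp
qed

section \<open>Turning of a vector seen from a rotating frame\<close>

text \<open>Without a descent, nonnegativity propagates from \<open>i\<close> up to
  \<open>n\<close>, returns to 0 by periodicity and then reaches \<open>j\<close>.\<close>

lemma exists_sign_descent:
  fixes f :: "nat \<Rightarrow> real"
  assumes "i < n" "f i \<ge> 0" "j < n" "f j < 0" and per: "f n = f 0"
  shows "\<exists>k<n. f k \<ge> 0 \<and> f (Suc k) < 0"
proof (rule ccontr)
  assume "\<not> ?thesis"
  then have step: "k < n \<Longrightarrow> f k \<ge> 0 \<Longrightarrow> f (Suc k) \<ge> 0" for k
    by (meson not_le)
  have up: "f l \<ge> 0" if "f k \<ge> 0" "k \<le> l" "l \<le> n" for k l
    using that(2,1,3) by (induction l rule: dec_induct) (auto intro: step)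
  have "f 0 \<ge> 0"
    using up [of i n] assms by simp
  then show False
    using up [of 0 j] assms by simp
qed

text \<open>In the frame, \<open>a i\<close> and \<open>b i\<close> are the positions before and
  after edge \<open>i\<close>. Edges never cross the cut of \<open>Arg\<close>, so the total is
  \<open>2 * pi\<close> times the number of crossings at frame changes, minus one turn of the frame.
  It remains to find one crossing.\<close>

lemma sum_Arg_nonneg_of_rotating_frame:
  fixes Q F :: "nat \<Rightarrow> complex"
  assumes per: "Q n = Q 0" "F n = F 0" and n: "n > 0"
    and edge: "\<And>i. i < n \<Longrightarrow> Im (cnj (F i) * Q (Suc i)) = Im (cnj (F i) * Q i)"
    and Q: "\<And>i. i \<le> n \<Longrightarrow> Q i \<noteq> 0" 
    and avoid: "\<And>i. i < n \<Longrightarrow> Q (Suc i) / Q i \<notin> \<real>\<^sub>\<le>\<^sub>0"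
    and rot: "\<And>i. i < n \<Longrightarrow> 0 < Im (F i / F (Suc i))"
    and turn: "(\<Sum>i<n. Arg (F i / F (Suc i))) = 2 * pi"
    and zero: "(\<Sum>i<n. Im (cnj (F i) * Q i)) = 0"
  shows "0 \<le> (\<Sum>i<n. Arg (Q (Suc i) / Q i))"
proof -
  define a where "a = (\<lambda>i. Q i / F i)"
  define b where "b = (\<lambda>i. Q (Suc i) / F i)"
  have F: "F i \<noteq> 0" if "i \<le> n" for i
    using that rot [of i] rot [of 0] n per by (cases "i = n") auto
  have Im_a: "Im (a i) = Im (cnj (F i) * Q i) / (norm (F i))\<^sup>2" for i
    unfolding a_def by (simp add: complex_div_cnj [of "Q i"] mult.commute)
  have Im_b: "Im (b i) = Im (cnj (F i) * Q (Suc i)) / (norm (F i))\<^sup>2" for i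
    unfolding b_def by (simp add: complex_div_cnj [of "Q (Suc i)"] mult.commute)
  have Im_ab: "Im (b i) = Im (a i)" if "i < n" for i
    using Im_a Im_b edge that by simp
  have edge_step: "Arg (Q (Suc i) / Q i) = Arg (b i) - Arg (a i)" if "i < n" for i
  proof -
    have "Q (Suc i) / Q i = b i / a i"
      unfolding a_def b_def using F [of i] that by simp
    then show ?thesis
      using Arg_divide_not_nonpos [of "a i" "b i"] Im_ab [OF that] avoid [OF that]
        Q [of i] Q [of "Suc i"] F [of i] that by (auto simp: a_def b_def)
  qed
  have ratio: "a (Suc i) / b i = F i / F (Suc i)" if "i < n" for i
    unfolding a_def b_def using Q [of "Suc i"] that by simp
  \<comment> \<open>One round in the frame alternates edge moves from \<open>a i\<close> to
    \<open>b i\<close> and rotations from \<open>b i\<close> to \<open>a (Suc i)\<close>; the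
    arguments of the endpoints telescope, and only the crossings remain.\<close>
  have "(\<Sum>i<n. Arg (Q (Suc i) / Q i)) + 2 * pi
      = (\<Sum>i<n. Arg (b i) - Arg (a i)) + (\<Sum>i<n. Arg (a (Suc i) / b i))"
    unfolding turn [symmetric] by (simp add: edge_step ratio)
  also have "\<dots> = (\<Sum>i<n. Arg (a (Suc i)) - Arg (a i))
      + 2 * pi * card {i \<in> {..<n}. 0 \<le> Im (b i) \<and> Im (a (Suc i)) < 0}" (is "_ = _ + 2 * pi * card ?K")
    by (subst sum_Arg_ccw) (auto simp: ratio rot sum.distrib sum_subtractf)
  also have "(\<Sum>i<n. Arg (a (Suc i)) - Arg (a i)) = 0"
    using sum_lessThan_telescope [of "\<lambda>i. Arg (a i)" n] per by (simp add: a_def)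
  finally have total: "(\<Sum>i<n. Arg (Q (Suc i) / Q i)) + 2 * pi = 2 * pi * card ?K"
    by simp
  define \<kappa> where "\<kappa> = (\<lambda>i. Im (cnj (F i) * Q i))"
  have Im_a': "Im (a i) = \<kappa> i / (norm (F i))\<^sup>2" for i
    unfolding \<kappa>_def by (rule Im_a)
  have sign: "Im (a i) \<ge> 0 \<longleftrightarrow> \<kappa> i \<ge> 0" if "i < n" for i
  proof -
    have "0 < (norm (F i))\<^sup>2"
      using F [of i] that by simp
    then show ?thesis
      unfolding Im_a' by (simp add: zero_le_divide_iff)
  qed
  \<comment> \<open>If all heights vanished, \<open>b 0\<close> and \<open>a 1\<close> would both be
    real, although the frame change between them is a proper rotation.\<close>
  have "\<exists>i<n. \<kappa> i \<noteq> 0"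
  proof (rule ccontr)
    assume "\<not> ?thesis"
    then have lt: "\<kappa> i = 0" if "i < n" for i
      using that by blast
    have "\<kappa> n = \<kappa> 0"
      unfolding \<kappa>_def per ..
    moreover have "n = 1 \<or> 1 < n"
      using n by linarith
    ultimately have "\<kappa> 0 = 0" "\<kappa> 1 = 0"
      using lt n by metis+
    then have "Im (b 0) = 0" "Im (a 1) = 0"
      using Im_ab [OF n] Im_a' by simp_all
    then have "Im (a 1 / b 0) = 0"
      by (simp add: Im_divide)
    then show False
      using ratio [OF n] rot [OF n] by simp
  qed
  then obtain l where l: "l < n" "\<kappa> l \<noteq> 0"
    by blast
  have zero': "(\<Sum>i<n. \<kappa> i) = 0"
    using zero unfolding \<kappa>_def .
  have "\<exists>j<n. \<kappa> j < 0"
  proof (rule ccontr)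
    assume "\<not> ?thesis"
    then have "0 \<le> \<kappa> i" if "i \<in> {..<n}" for i
      using that by (meson lessThan_iff not_le)
    from sum_nonneg_eq_0_iff [of "{..<n}" \<kappa>, OF finite_lessThan this] zero'
    have "\<forall>i\<in>{..<n}. \<kappa> i = 0"
      by blast
    with l show False by auto
  qed
  moreover have "\<exists>i<n. 0 \<le> \<kappa> i"
  proof (rule ccontr)
    assume "\<not> ?thesis"
    then have "(\<Sum>i<n. \<kappa> i) < (\<Sum>i<n. 0)"
      using n by (intro sum_strict_mono) auto
    with zero' show False by simp
  qed
  ultimately obtain i j where "i < n" "0 \<le> Im (a i)" "j < n" "Im (a j) < 0"
    using sign by (meson not_le)
  then have "\<exists>k<n. Im (a k) \<ge> 0 \<and> Im (a (Suc k)) < 0"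
    using exists_sign_descent [of i n "\<lambda>i. Im (a i)" j] per by (simp add: a_def)
  \<comment> \<open>The edge keeps the height, so the change of sign takes place at the frame
    change, where it is counted.\<close>
  then obtain k where "k \<in> ?K"
    using Im_ab by (metis (mono_tags, lifting) lessThan_iff mem_Collect_eq)
  then have "?K \<noteq> {}"
    by blast
  then have "card ?K \<ge> 1"
    by (simp add: Suc_le_eq card_gt_0_iff)
  then have "2 * pi * 1 \<le> 2 * pi * real (card ?K)"
    by (intro mult_left_mono) auto
  with total show ?thesis
    by linarith
qed

text \<open>The sum is \<open>2 * pi\<close> times the number of crossings of the cut. All terms are
  positive, so there is at least one crossing; \<open>unique\<close> allows no second one.\<close>

lemma sum_Arg_cw_eq_2pi:
  fixes F :: "nat \<Rightarrow> complex"
  assumes per: "F n = F 0" and n: "n > 0"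
    and rot: "\<And>i. i < n \<Longrightarrow> 0 < Im (F i / F (Suc i))"
    and unique: "\<And>i j. \<lbrakk>i < n; j < n; 0 \<le> Im (F (Suc i)); Im (F i) < 0;
        0 \<le> Im (F (Suc j)); Im (F j) < 0\<rbrakk> \<Longrightarrow> i = j"
  shows "(\<Sum>i<n. Arg (F i / F (Suc i))) = 2 * pi"
proof -
  let ?K = "{i \<in> {..<n}. 0 \<le> Im (F (Suc i)) \<and> Im (F i) < 0}"
  have "(\<Sum>i<n. Arg (F i) - Arg (F (Suc i))) = 0"
    using sum_lessThan_telescope' [of "\<lambda>i. Arg (F i)" n] per by simp
  then have eq: "(\<Sum>i<n. Arg (F i / F (Suc i))) = 2 * pi * card ?K"
    using sum_Arg_ccw [of n F "\<lambda>i. F (Suc i)"] rot by simp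
  have "0 < (\<Sum>i<n. Arg (F i / F (Suc i)))"
    using rot Arg_lt_pi n by (intro sum_pos) auto
  then have "0 < 2 * pi * card ?K"
    unfolding eq .
  then have "card ?K \<noteq> 0"
    by (intro notI) (simp only: of_nat_0 mult_zero_right less_irrefl)
  moreover have "card ?K \<le> 1"
    by (auto simp: card_le_Suc0_iff_eq intro: unique)
  ultimately have "card ?K = 1"
    by linarith
  then show ?thesis
    using eq by simp
qed

section \<open>Closed polygonal paths\<close>

lemma pathstart_polygonal_path [simp]: "ps \<noteq> [] \<Longrightarrow> pathstart (polygonal_path ps) = hd ps"
  by (induction ps rule: polygonal_path.induct) auto

lemma pathfinish_polygonal_path [simp]: "ps \<noteq> [] \<Longrightarrow> pathfinish (polygonal_path ps) = last ps"
  by (induction ps rule: polygonal_path.induct) auto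

lemma path_polygonal_path [simp]: "path (polygonal_path ps)"
proof (induction ps rule: polygonal_path.induct)
  case (4 a b c ps)
  then show ?case by simp
qed (auto simp: path_def)

lemma path_image_polygonal_path_single: "path_image (polygonal_path [a]) = {a}"
  by (simp del: linepath_refl)

lemma path_image_polygonal_path_Cons:
  "path_image (polygonal_path (a # b # ps)) = closed_segment a b \<union> path_image (polygonal_path (b # ps))"
proof (cases ps)
  case Nil
  then show ?thesis
    using path_image_polygonal_path_single [of b] by auto
next
  case (Cons c qs)
  then show ?thesis by (simp add: path_image_join)
qed

lemma path_image_polygonal_path_snoc:
  "path_image (polygonal_path (ps @ [a, b])) = path_image (polygonal_path (ps @ [a])) \<union> closed_segment a b"
proof (induction ps)
  case (Cons x ps)
  then show ?case
    by (cases ps) (simp_all add: path_image_polygonal_path_Cons Un_assoc del: polygonal_path.simps(4))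
qed (auto simp: path_image_polygonal_path_Cons path_image_polygonal_path_single
    simp del: polygonal_path.simps)

lemma path_image_polygonal_path_rev:
  "path_image (polygonal_path (rev ps)) = path_image (polygonal_path ps)"
proof (induction ps rule: polygonal_path.induct)
  case (4 a b c ps)
  then show ?case
    using path_image_polygonal_path_snoc [of "rev (c # ps)" b a]
    by (auto simp: path_image_polygonal_path_Cons closed_segment_commute simp del: polygonal_path.simps)
qed (auto simp: closed_segment_commute)

lemma segment_subset_path_image_polygonal_path:
  "Suc i < length ps \<Longrightarrow> closed_segment (ps ! i) (ps ! Suc i) \<subseteq> path_image (polygonal_path ps)"
proof (induction ps arbitrary: i rule: polygonal_path.induct)
  case (4 a b c ps)
  then show ?case
    by (cases i) (auto simp: path_image_polygonal_path_Cons simp del: polygonal_path.simps)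
qed auto

lemma set_subset_path_image_polygonal_path: "set ps \<subseteq> path_image (polygonal_path ps)"
proof (induction ps rule: polygonal_path.induct)
  case (4 a b c ps)
  then show ?case
    by (auto simp: path_image_polygonal_path_Cons simp del: polygonal_path.simps)
qed auto

lemma arc_linepath_iff: "arc (linepath a b) \<longleftrightarrow> a \<noteq> b"
  by (metis arc_distinct_ends arc_linepath pathfinish_linepath pathstart_linepath)

lemma arc_polygonal_path_Cons:
  assumes "ps \<noteq> []"
  shows "arc (polygonal_path (a # b # ps)) \<longleftrightarrow> a \<noteq> b \<and> arc (polygonal_path (b # ps))
     \<and> closed_segment a b \<inter> path_image (polygonal_path (b # ps)) \<subseteq> {b}"
proof -
  obtain c qs where "ps = c # qs"
    using assms by (cases ps) auto
  then show ?thesis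
    by (simp add: arc_join_eq arc_linepath_iff del: linepath_refl)
qed

text \<open>\<open>polygonal_path\<close> joins its segments from the right, so a segment appended
  at the end gives a different parametrization. Rebracketing preserves the property of being an
  arc.\<close>

lemma arc_polygonal_path_snoc:
  assumes "ps \<noteq> []"
  shows "arc (polygonal_path (ps @ [a, b])) \<longleftrightarrow> arc (polygonal_path (ps @ [a]) +++ linepath a b)"
  using assms
proof (induction ps rule: list_nonempty_induct)
  case (single x)
  then show ?case by simp
next
  case (cons x ps)
  obtain y qs where ps: "ps = y # qs"
    using cons by (cases ps) auto
  have "arc (polygonal_path (x # ps @ [a, b])) \<longleftrightarrow> arc (linepath x y +++ polygonal_path (ps @ [a, b]))"
    unfolding ps by (cases qs) auto
  also have "\<dots> \<longleftrightarrow> arc (linepath x y +++ polygonal_path (ps @ [a]) +++ linepath a b)"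
    using cons.IH path_image_polygonal_path_snoc [of ps a b] by (simp add: ps arc_join_eq path_image_join)
  also have "\<dots> \<longleftrightarrow> arc ((linepath x y +++ polygonal_path (ps @ [a])) +++ linepath a b)"
    by (intro arc_assoc) (auto simp: ps)
  also have "linepath x y +++ polygonal_path (ps @ [a]) = polygonal_path (x # ps @ [a])"
    unfolding ps by (cases qs) auto
  finally show ?case by simp
qed

text \<open>The path of the reversed list is in general not the reversed path, because the
  parametrizations differ; hence the induction through images and arcs.\<close>

lemma arc_polygonal_path_rev: "arc (polygonal_path ps) \<Longrightarrow> arc (polygonal_path (rev ps))"
proof (induction ps rule: polygonal_path.induct)
  case (3 a b)
  then show ?case by (auto simp: arc_linepath_iff)
next
  case (4 a b c ps)
  have *: "a \<noteq> b" "arc (polygonal_path (b # c # ps))"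
    "closed_segment a b \<inter> path_image (polygonal_path (b # c # ps)) \<subseteq> {b}"
    using 4(2) arc_polygonal_path_Cons [of "c # ps"] by blast+
  have "path_image (polygonal_path (rev (c # ps) @ [b])) = path_image (polygonal_path (b # c # ps))"
    using path_image_polygonal_path_rev [of "b # c # ps"] by simp
  moreover have "arc (polygonal_path (rev (c # ps) @ [b]))"
    using 4(1) * by simp
  ultimately have "arc (polygonal_path (rev (c # ps) @ [b]) +++ linepath b a)"
    using * by (subst arc_join_eq) (auto simp: closed_segment_commute)
  then show ?case
    using arc_polygonal_path_snoc [of "rev (c # ps)" b a] by simp
qed auto

lemma arc_polygonal_path_distinct: "arc (polygonal_path ps) \<Longrightarrow> distinct ps"
proof (induction ps rule: polygonal_path.induct)
  case (3 a b)
  then show ?case by (simp add: arc_linepath_iff)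
next
  case (4 a b c ps)
  have *: "a \<noteq> b" "arc (polygonal_path (b # c # ps))"
    "closed_segment a b \<inter> path_image (polygonal_path (b # c # ps)) \<subseteq> {b}"
    using 4(2) arc_polygonal_path_Cons [of "c # ps"] by blast+
  have "a \<notin> set (b # c # ps)"
    using * set_subset_path_image_polygonal_path [of "b # c # ps"] by auto
  with 4(1) * show ?case by simp
qed auto

text \<open>Cutting off the first edge leaves an arc, to which the recursive characterizations
  apply.\<close>

lemma simple_polygon_iff_arc:
  assumes "ps \<noteq> []"
  shows "simple_polygon (a # ps) \<longleftrightarrow> length ps \<ge> 2 \<and> a \<noteq> hd ps \<and> arc (polygonal_path (ps @ [a])) \<and>
     closed_segment a (hd ps) \<inter> path_image (polygonal_path (ps @ [a])) \<subseteq> {a, hd ps}"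
proof -
  obtain b qs where ps: "ps = b # qs"
    using assms by (cases ps) auto
  have "simple_path (polygonal_path (a # ps @ [a])) \<longleftrightarrow> simple_path (linepath a b +++ polygonal_path (ps @ [a]))"
    unfolding ps by (cases qs) auto
  also have "\<dots> \<longleftrightarrow> arc (linepath a b) \<and> arc (polygonal_path (ps @ [a])) \<and>
     closed_segment a b \<inter> path_image (polygonal_path (ps @ [a])) \<subseteq> {a, b}"
    by (subst simple_path_join_loop_eq) (auto simp: ps)
  finally show ?thesis
    by (auto simp: simple_polygon_def closed_polygon_def ps arc_linepath_iff)
qed

lemma simple_polygon_distinct:
  assumes "simple_polygon ps"
  shows "distinct ps"
proof -
  obtain a qs where ps: "ps = a # qs" "qs \<noteq> []"
    using assms by (cases ps) (force simp: simple_polygon_def)+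
  then have "distinct (qs @ [a])"
    using assms simple_polygon_iff_arc arc_polygonal_path_distinct by blast
  then show ?thesis
    using ps by simp
qed

lemma boundary_rev: "boundary (a # rev ps) = boundary (a # ps)"
  using path_image_polygonal_path_rev [of "a # ps @ [a]"]
  by (simp add: boundary_def closed_polygon_def)

text \<open>The base vertex \<open>a\<close> stays first. The edge from \<open>a\<close> to
  \<open>b\<close> is cut off, the remaining arc is reversed, and the edge is attached again at the
  other end.\<close>

lemma simple_polygon_rev:
  assumes "simple_polygon (a # ps)"
  shows "simple_polygon (a # rev ps)"
proof -
  obtain b c qs where ps: "ps = b # qs @ [c]"
  proof -
    have "length ps \<ge> 2"
      using assms by (simp add: simple_polygon_def)
    then show thesis
      using that by (cases ps; cases "tl ps" rule: rev_cases) auto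
  qed
  let ?g = "polygonal_path (c # rev qs @ [b])"
  have *: "a \<noteq> b" "arc (polygonal_path (ps @ [a]))"
      "closed_segment a b \<inter> path_image (polygonal_path (ps @ [a])) \<subseteq> {a, b}"
    using assms simple_polygon_iff_arc [of ps a] by (auto simp: ps)
  have step: "polygonal_path (a # c # l @ [x]) = linepath a c +++ polygonal_path (c # l @ [x])" for l x
    by (cases l) auto
  have arc: "arc (linepath a c +++ ?g)"
    using arc_polygonal_path_rev [OF *(2)] step [of "rev qs" b] by (simp add: ps)
  have image: "path_image (linepath a c +++ ?g) = path_image (polygonal_path (ps @ [a]))"
    using path_image_polygonal_path_rev [of "ps @ [a]"] step [of "rev qs" b] by (simp add: ps)
  have "simple_path ((linepath a c +++ ?g) +++ linepath b a)"
    using * arc image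
    by (intro simple_path_join_loop) (auto simp: arc_linepath closed_segment_commute)
  then have simple: "simple_path (linepath a c +++ ?g +++ linepath b a)"
    by (subst simple_path_assoc) auto
  \<comment> \<open>The two bracketings of the tail agree in image and in being an arc, which is all
    that the criterion for a simple loop uses.\<close>
  have "polygonal_path (a # rev ps @ [a]) = linepath a c +++ polygonal_path ((c # rev qs) @ [b, a])"
    using step [of "rev qs @ [b]" a] by (simp add: ps)
  moreover have "path_image (polygonal_path ((c # rev qs) @ [b, a])) = path_image (?g +++ linepath b a)"
    using path_image_polygonal_path_snoc [of "c # rev qs" b a] by (simp add: path_image_join)
  moreover have "arc (polygonal_path ((c # rev qs) @ [b, a])) \<longleftrightarrow> arc (?g +++ linepath b a)"
    using arc_polygonal_path_snoc [of "c # rev qs" b a] by simp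
  ultimately have "simple_path (polygonal_path (a # rev ps @ [a]))"
    using simple by (simp add: simple_path_join_loop_eq)
  then show ?thesis
    using assms by (simp add: simple_polygon_def closed_polygon_def)
qed

section \<open>Winding numbers as sums of arguments\<close>

text \<open>Off the segment, \<open>(w - z) / (a - z)\<close> avoids the branch cut while
  \<open>w\<close> runs along it, so its logarithm is a primitive of \<open>1 / (w - z)\<close>. The
  real part of the winding number retains only the argument.\<close>

lemma Re_winding_number_linepath:
  assumes "z \<notin> closed_segment a b"
  shows "Re (winding_number (linepath a b) z) = Arg ((b - z) / (a - z)) / (2 * pi)"
    and "(b - z) / (a - z) \<notin> \<real>\<^sub>\<le>\<^sub>0"
proof -
  have az: "a \<noteq> z" "b \<noteq> z"
    using assms by auto
  have seg: "(w - z) / (a - z) \<notin> \<real>\<^sub>\<le>\<^sub>0" if w: "w \<in> closed_segment a b" for w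
  proof
    assume "(w - z) / (a - z) \<in> \<real>\<^sub>\<le>\<^sub>0"
    then obtain r where r: "r \<le> 0" "(w - z) / (a - z) = of_real r"
      by (auto elim: nonpos_Reals_cases)
    then have "w - z = of_real r * (a - z)"
      using az by (simp add: field_simps)
    \<comment> \<open>Solving \<open>w - z = r * (a - z)\<close> for \<open>z\<close> gives the
      weight \<open>1 / (1 - r)\<close> at \<open>w\<close>, which lies between 0 and 1 because
      \<open>r \<le> 0\<close>.\<close>
    then have "z = (1 - 1 / (1 - r)) *\<^sub>R a + (1 / (1 - r)) *\<^sub>R w"
      using r(1) by (simp add: scaleR_conv_of_real divide_simps) (auto simp: algebra_simps)
    moreover have "0 \<le> 1 / (1 - r)" "1 / (1 - r) \<le> 1"
      using r(1) by auto
    ultimately have "z \<in> closed_segment a w"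
      unfolding closed_segment_def by blast
    moreover have "closed_segment a w \<subseteq> closed_segment a b"
      using w by (simp add: subset_closed_segment)
    ultimately show False
      using assms by blast
  qed
  show "(b - z) / (a - z) \<notin> \<real>\<^sub>\<le>\<^sub>0"
    using seg by simp
  have "((\<lambda>w. 1 / (w - z)) has_contour_integral
      Ln ((pathfinish (linepath a b) - z) / (a - z)) - Ln ((pathstart (linepath a b) - z) / (a - z))) (linepath a b)"
  proof (rule contour_integral_primitive)
    fix w assume "w \<in> closed_segment a b"
    then show "((\<lambda>w. Ln ((w - z) / (a - z))) has_field_derivative 1 / (w - z)) (at w within closed_segment a b)"
      using seg [of w] az assms by (auto intro!: derivative_eq_intros)
  qed auto
  then have "((\<lambda>w. 1 / (w - z)) has_contour_integral Ln ((b - z) / (a - z))) (linepath a b)"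
    using az by simp
  then have "winding_number (linepath a b) z = 1 / (2 * pi * \<i>) * Ln ((b - z) / (a - z))"
    using assms by (simp add: winding_number_valid_path contour_integral_unique)
  then show "Re (winding_number (linepath a b) z) = Arg ((b - z) / (a - z)) / (2 * pi)"
    using az by (simp add: Arg_def Re_divide power2_eq_square)
qed

lemma Re_winding_number_polygonal_path:
  assumes "z \<notin> path_image (polygonal_path ps)" "ps \<noteq> []"
  shows "Re (winding_number (polygonal_path ps) z) =
    (\<Sum>i<length ps - 1. Arg ((ps ! Suc i - z) / (ps ! i - z))) / (2 * pi)"
  using assms
proof (induction ps rule: polygonal_path.induct)
  case (3 a b)
  then show ?case
    by (simp add: Re_winding_number_linepath)
next
  case (4 a b c ps)
  have z: "z \<notin> closed_segment a b" "z \<notin> path_image (polygonal_path (b # c # ps))"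
    using 4(2) by (simp_all add: path_image_polygonal_path_Cons del: polygonal_path.simps)
  have "winding_number (polygonal_path (a # b # c # ps)) z =
      winding_number (linepath a b) z + winding_number (polygonal_path (b # c # ps)) z"
    unfolding polygonal_path.simps(4) by (rule winding_number_join) (use z in auto)
  then show ?case
    using 4(1) z Re_winding_number_linepath [OF z(1)]
    by (simp add: sum.lessThan_Suc_shift add_divide_distrib del: polygonal_path.simps sum.lessThan_Suc)
qed auto

section \<open>Sides and corners of a convex polygon\<close>

text \<open>The determinant of the two vectors, positive when \<open>b\<close> points to the left of
  \<open>a\<close>.\<close>

definition cross :: "complex \<Rightarrow> complex \<Rightarrow> real" where
  "cross a b = Im (cnj a * b)"

lemma cross_eq: "cross a b = Re a * Im b - Im a * Re b"
  by (simp add: cross_def)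

text \<open>Multiplication by the imaginary unit is a quarter turn; in this form the library facts
  on half-spaces and hyperplanes apply.\<close>

lemma cross_eq_inner: "cross a b = (\<i> * a) \<bullet> b"
  by (simp add: cross_def inner_complex_def)

lemma cross_eq_0_imp_collinear:
  assumes "cross (v - u) (w - u) = 0"
  shows "collinear {u, v, w}"
proof (cases "v = u")
  case False
  have "Im ((w - u) / (v - u)) = 0"
    using assms by (simp add: cross_eq Im_divide mult.commute)
  then obtain c where "(w - u) / (v - u) = of_real c"
    by (metis complex_is_Real_iff Reals_cases)
  then have "w - u = c *\<^sub>R (v - u)"
    using False by (simp add: field_simps scaleR_conv_of_real)
  then have "collinear {0, v - u, w - u}"
    unfolding collinear_lemma by blast
  then have "collinear {v, u, w}"
    by (subst collinear_3) auto
  then show ?thesis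
    by (simp add: insert_commute)
qed auto

text \<open>Of three collinear points one lies between the other two, which an extreme point cannot
  do.\<close>

lemma extreme_points_cross_nonzero:
  assumes "u extreme_point_of N" "v extreme_point_of N" "w extreme_point_of N"
    and "u \<noteq> v" "v \<noteq> w" "u \<noteq> w"
  shows "cross (v - u) (w - u) \<noteq> 0"
proof
  assume "cross (v - u) (w - u) = 0"
  then have "u \<in> closed_segment v w \<or> v \<in> closed_segment w u \<or> w \<in> closed_segment u v"
    using cross_eq_0_imp_collinear collinear_between_cases between_mem_segment by metis
  then show False
    using assms unfolding extreme_point_of_def open_segment_def by auto
qed

lemma cross_nonneg_convex_hull:
  assumes "\<And>t. t \<in> S \<Longrightarrow> 0 \<le> cross a (t - v)" and "z \<in> convex hull S"
  shows "0 \<le> cross a (z - v)"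
proof -
  have "convex hull S \<subseteq> {z. (\<i> * a) \<bullet> z \<ge> (\<i> * a) \<bullet> v}"
    using assms(1) by (intro hull_minimal convex_halfspace_ge)
      (auto simp: cross_eq_inner inner_diff_right simp del: inner_mult_left)
  with assms(2) show ?thesis
    by (auto simp: cross_eq_inner inner_diff_right)
qed

lemma interior_subset_line_empty:
  assumes "N \<subseteq> {z. cross a (z - u) = 0}" "a \<noteq> 0"
  shows "interior N = {}"
proof -
  have "N \<subseteq> {z. (\<i> * a) \<bullet> z = (\<i> * a) \<bullet> u}"
    using assms(1) by (auto simp: cross_eq_inner inner_diff_right)
  then have "interior N \<subseteq> interior {z. (\<i> * a) \<bullet> z = (\<i> * a) \<bullet> u}"
    by (rule interior_mono)
  then show ?thesis
    using assms(2) by (simp add: interior_hyperplane)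
qed

section \<open>The two edges at a corner\<close>

text \<open>The hull stays convex when an extreme point is removed, so \<open>v\<close> is outside
  the compact hull of the other generators and can be strictly separated from it.\<close>

lemma extreme_point_strict_support:
  assumes "finite S" "v extreme_point_of (convex hull S)"
  obtains a :: complex where "\<And>t. t \<in> S - {v} \<Longrightarrow> 0 < a \<bullet> (t - v)"
proof -
  have "convex (convex hull S - {v})"
    using assms(2) by (simp add: extreme_point_of_stillconvex)
  then have "convex hull (S - {v}) \<subseteq> convex hull S - {v}"
    by (intro hull_minimal) (auto intro: hull_inc)
  then have "v \<notin> convex hull (S - {v})"
    by blast
  moreover have "closed (convex hull (S - {v}))"
    using assms(1) by (intro compact_imp_closed finite_imp_compact_convex_hull) simp
  ultimately obtain a b where "a \<bullet> v < b" "\<forall>x\<in>convex hull (S - {v}). b < a \<bullet> x"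
    using separating_hyperplane_closed_point [OF convex_convex_hull] by blast
  then have "0 < a \<bullet> (t - v)" if "t \<in> S - {v}" for t
    using that hull_inc [of t "S - {v}"] by (force simp: inner_diff_right)
  then show thesis
    by (rule that)
qed

text \<open>Seen from a direction \<open>a\<close> pointing strictly into the polygon, \<open>cross a t / (a \<bullet> t)\<close> is the
  tangent of the angle of \<open>t\<close>; its extrema over the generators give the two sides at \<open>v\<close>.\<close>

lemma extreme_point_extreme_ray:
  assumes "finite S" "v extreme_point_of (convex hull S)" "S - {v} \<noteq> {}" and s: "s = 1 \<or> s = - 1"
  obtains t\<^sub>0 where "t\<^sub>0 \<in> S - {v}" "\<And>t. t \<in> S \<Longrightarrow> 0 \<le> cross (of_real s * (t\<^sub>0 - v)) (t - v)"
proof -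
  obtain a where a: "\<And>t. t \<in> S - {v} \<Longrightarrow> 0 < a \<bullet> (t - v)"
    using extreme_point_strict_support assms(1,2) by blast
  \<comment> \<open>The sign \<open>s\<close> selects the extremum: minimizing \<open>f\<close>
    gives the clockwise-most ray for \<open>s = 1\<close> and the counterclockwise-most one for
    \<open>s = - 1\<close>.\<close>
  define f where "f t = s * cross a (t - v) / (a \<bullet> (t - v))" for t
  obtain t\<^sub>0 where t0: "t\<^sub>0 \<in> S - {v}" "\<And>t. t \<in> S - {v} \<Longrightarrow> f t\<^sub>0 \<le> f t"
    using ex_is_arg_min_if_finite [of "S - {v}" f] assms(1,3)
    unfolding is_arg_min_linorder by blast
  have "0 \<le> cross (of_real s * (t\<^sub>0 - v)) (t - v)" if t: "t \<in> S" for t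
  proof (cases "t = v")
    case False
    then have pos: "0 < a \<bullet> (t - v)" "0 < a \<bullet> (t\<^sub>0 - v)"
      using a t t0(1) by auto
    have "f t\<^sub>0 \<le> f t"
      using t0 t False by blast
    then have "0 \<le> s * (a \<bullet> (t\<^sub>0 - v) * cross a (t - v) - cross a (t\<^sub>0 - v) * (a \<bullet> (t - v)))"
      using pos by (simp add: f_def divide_simps) (simp add: algebra_simps)
    also have "\<dots> = (a \<bullet> a) * cross (of_real s * (t\<^sub>0 - v)) (t - v)"
      unfolding cross_eq inner_complex_def by (simp add: algebra_simps)
    finally have "0 \<le> (a \<bullet> a) * cross (of_real s * (t\<^sub>0 - v)) (t - v)" .
    moreover have "0 < a \<bullet> a"
      using pos by auto
    ultimately show ?thesis
      by (simp add: zero_le_mult_iff del: inner_gt_zero_iff)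
  qed (simp add: cross_eq)
  with t0(1) show thesis
    using that by blast
qed

text \<open>The line through \<open>v\<close> along an extreme ray supports the hull. Its face is
  compact, convex and collinear, hence a segment, and the extreme point \<open>v\<close> is one of
  its ends. The sign \<open>s\<close> chooses between the edge leaving \<open>v\<close> and the edge
  arriving there.\<close>

lemma convex_hull_edge_at_corner:
  assumes S: "finite S" "v extreme_point_of (convex hull S)" and int: "interior (convex hull S) \<noteq> {}"
    and s: "s = 1 \<or> s = - 1"
  obtains x where "x \<noteq> v" "closed_segment v x edge_of (convex hull S)"
    "\<And>z. z \<in> convex hull S \<Longrightarrow> 0 \<le> cross (of_real s * (x - v)) (z - v)"
proof -
  let ?N = "convex hull S"
  have "S - {v} \<noteq> {}"
  proof
    assume "S - {v} = {}"
    then have "?N \<subseteq> {v}"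
      by (intro hull_minimal) auto
    then have "interior ?N \<subseteq> interior {v}"
      by (rule interior_mono)
    with int show False by simp
  qed
  then obtain t where t: "t \<in> S - {v}" and nonneg: "\<And>r. r \<in> S \<Longrightarrow> 0 \<le> cross (of_real s * (t - v)) (r - v)"
    using extreme_point_extreme_ray [OF S _ s] by metis
  define F where "F = ?N \<inter> {z. (\<i> * (of_real s * (t - v))) \<bullet> z = (\<i> * (of_real s * (t - v))) \<bullet> v}"
  have N: "0 \<le> cross (of_real s * (t - v)) (z - v)" if "z \<in> ?N" for z
    using cross_nonneg_convex_hull nonneg that by blast
  have face: "F face_of ?N"
    unfolding F_def using N
    by (intro face_of_Int_supporting_hyperplane_ge) (auto simp: cross_eq_inner inner_diff_right)
  have "v \<in> ?N"
    using S(2) by (simp add: extreme_point_of_def)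
  then have vF: "v \<in> F"
    by (simp add: F_def)
  have zF: "cross (t - v) (z - v) = 0" if "z \<in> F" for z
  proof -
    have "cross (of_real s * (t - v)) (z - v) = 0"
      using that by (simp add: F_def cross_eq_inner inner_diff_right)
    then show ?thesis
      using s by (auto simp: cross_eq)
  qed
  have "cross (of_real s * (t - v)) (t - v) = 0"
    by (simp add: cross_eq)
  then have tF: "t \<in> F"
    using t hull_inc [of t S] by (simp add: F_def cross_eq_inner inner_diff_right)
  have "collinear F"
  proof -
    have "\<exists>c. z = v + c *\<^sub>R (t - v)" if "z \<in> F" for z
    proof -
      have "collinear {v, t, z}"
        using cross_eq_0_imp_collinear zF [OF that] by blast
      then have "collinear {t, v, z}"
        by (simp add: insert_commute)
      then have "collinear {0, t - v, z - v}"
        using collinear_3 [of t v z] by simp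
      show ?thesis
      proof (cases "z = v")
        case False
        with \<open>collinear {0, t - v, z - v}\<close> t obtain c where "z - v = c *\<^sub>R (t - v)"
          unfolding collinear_lemma by auto
        then show ?thesis
          by (metis add.commute diff_add_cancel)
      qed (auto intro: exI [of _ 0])
    qed
    then show ?thesis
      unfolding collinear_alt by blast
  qed
  moreover have "compact F"
    using face_of_imp_compact [OF _ _ face] S(1) finite_imp_compact_convex_hull by blast
  ultimately obtain a b where ab: "F = closed_segment a b"
    using compact_convex_collinear_segment [of F] vF face_of_imp_convex [OF face] by blast
  have "v extreme_point_of F"
    using S(2) vF extreme_point_of_face [OF face] by blast
  then obtain x where x: "F = closed_segment v x"
    using ab by (metis closed_segment_commute extreme_point_of_segment)
  have xv: "x \<noteq> v"
    using tF t x by auto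
  have "aff_dim F = 1"
    unfolding x segment_convex_hull aff_dim_convex_hull using xv by simp
  then have edge: "closed_segment v x edge_of ?N"
    using face x by (simp add: edge_of_def)
  \<comment> \<open>The generator \<open>t\<close> need not be the far end \<open>x\<close>, but
    \<open>t - v\<close> is a positive multiple of \<open>x - v\<close>, so the support inequality
    carries over.\<close>
  obtain k where k: "0 \<le> k" "t = (1 - k) *\<^sub>R v + k *\<^sub>R x"
    using tF unfolding x closed_segment_def by blast
  have tv: "t - v = of_real k * (x - v)"
    using k(2) by (simp add: scaleR_conv_of_real algebra_simps)
  then have kpos: "0 < k"
    using k(1) t by (cases "k = 0") auto
  have "0 \<le> cross (of_real s * (x - v)) (z - v)" if "z \<in> ?N" for z
  proof -
    have "cross (of_real s * (t - v)) (z - v) = k * cross (of_real s * (x - v)) (z - v)"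
      unfolding tv cross_eq by (simp add: algebra_simps)
    then show ?thesis
      using N [OF that] kpos by (simp add: zero_le_mult_iff)
  qed
  with xv edge show thesis
    using that by blast
qed

section \<open>Incidence and turning of the oriented sides\<close>

lemma sideD:
  assumes "(u, w) \<in> sides N"
  shows "u \<noteq> w" "u extreme_point_of N" "w extreme_point_of N"
    "\<And>z. z \<in> N \<Longrightarrow> 0 \<le> cross (w - u) (z - u)"
proof -
  have edge: "closed_segment u w face_of N" "aff_dim (closed_segment u w) = 1"
    and "\<And>z. z \<in> N \<Longrightarrow> 0 \<le> Im (cnj (w - u) * (z - u))"
    using assms unfolding sides_def edge_of_def by auto
  then show "u \<noteq> w" "\<And>z. z \<in> N \<Longrightarrow> 0 \<le> cross (w - u) (z - u)"
    by (auto simp: cross_def)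
  show "u extreme_point_of N" "w extreme_point_of N"
    using extreme_point_of_face [OF edge(1)] extreme_point_of_segment by blast+
qed

lemma side_corners:
  assumes "(u, w) \<in> sides N"
  shows "u \<in> corners N" "w \<in> corners N" "u \<in> N" "w \<in> N"
  using sideD [OF assms] by (auto simp: corners_def extreme_point_of_def)

text \<open>Lying to the left of both orientations would confine \<open>N\<close> to a line, against
  its nonempty interior.\<close>

lemma sides_antisym:
  assumes "interior N \<noteq> {}" "(u, w) \<in> sides N" "(w, u) \<in> sides N"
  shows False
proof -
  have "N \<subseteq> {z. cross (w - u) (z - u) = 0}"
  proof
    fix z assume "z \<in> N"
    then have "0 \<le> cross (w - u) (z - u)" "0 \<le> cross (u - w) (z - w)"
      using assms sideD by blast+
    then show "z \<in> {z. cross (w - u) (z - u) = 0}"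
      by (simp add: cross_eq algebra_simps)
  qed
  then show False
    using interior_subset_line_empty assms sideD(1) by (metis right_minus_eq)
qed

text \<open>Each far end lies to the left of the other side, so the determinant vanishes and three
  distinct corners would be collinear.\<close>

lemma side_from_unique:
  assumes "(v, x) \<in> sides N" "(v, y) \<in> sides N"
  shows "x = y"
proof (rule ccontr)
  assume "x \<noteq> y"
  have "0 \<le> cross (x - v) (y - v)" "0 \<le> cross (y - v) (x - v)"
    using assms sideD(4) side_corners by blast+
  then have "cross (x - v) (y - v) = 0"
    by (simp add: cross_eq algebra_simps)
  then show False
    using extreme_points_cross_nonzero sideD assms \<open>x \<noteq> y\<close> by metis
qed

lemma side_to_unique:
  assumes "(x, v) \<in> sides N" "(y, v) \<in> sides N"
  shows "x = y"
proof (rule ccontr)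
  assume "x \<noteq> y"
  have "0 \<le> cross (v - x) (y - x)" "0 \<le> cross (v - y) (x - y)"
    using assms sideD(4) side_corners by blast+
  then have "cross (v - x) (y - x) = 0"
    by (simp add: cross_eq algebra_simps)
  then show False
    using extreme_points_cross_nonzero sideD assms \<open>x \<noteq> y\<close> by metis
qed

lemma side_from_exists:
  assumes "convex_lattice_polygon N" "v \<in> corners N"
  shows "\<exists>w. (v, w) \<in> sides N"
proof -
  obtain S where S: "finite S" "N = convex hull S" "interior N \<noteq> {}"
    using assms(1) by (auto simp: convex_lattice_polygon_def)
  then obtain x where "closed_segment v x edge_of N"
      "\<And>z. z \<in> N \<Longrightarrow> 0 \<le> cross (of_real 1 * (x - v)) (z - v)"
    using convex_hull_edge_at_corner [of S v 1] assms(2) unfolding corners_def by blast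
  then show ?thesis
    by (auto simp: sides_def cross_def)
qed

lemma side_to_exists:
  assumes "convex_lattice_polygon N" "v \<in> corners N"
  shows "\<exists>u. (u, v) \<in> sides N"
proof -
  obtain S where S: "finite S" "N = convex hull S" "interior N \<noteq> {}"
    using assms(1) by (auto simp: convex_lattice_polygon_def)
  then obtain x where x: "closed_segment v x edge_of N"
      "\<And>z. z \<in> N \<Longrightarrow> 0 \<le> cross (of_real (- 1) * (x - v)) (z - v)"
    using convex_hull_edge_at_corner [of S v "- 1"] assms(2) unfolding corners_def by blast
  \<comment> \<open>Moving the base point from \<open>v\<close> to \<open>x\<close> changes the
    second vector by a multiple of the first, which leaves the determinant unchanged.\<close>
  have "0 \<le> Im (cnj (v - x) * (z - x))" if "z \<in> N" for z
    using x(2) [OF that] by (simp add: cross_eq algebra_simps)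
  then show ?thesis
    using x(1) by (auto simp: sides_def closed_segment_commute)
qed

lemma side_turn:
  assumes "interior N \<noteq> {}" "(u, v) \<in> sides N" "(v, w) \<in> sides N"
  shows "0 < cross (v - u) (w - v)"
proof -
  have "u \<noteq> w"
    using sides_antisym assms by blast
  then have "cross (v - u) (w - u) \<noteq> 0"
    using extreme_points_cross_nonzero sideD assms by metis
  moreover have "0 \<le> cross (v - u) (w - u)"
    using sideD(4) side_corners assms by blast
  ultimately show ?thesis
    by (simp add: cross_eq algebra_simps)
qed

text \<open>\<open>N\<close> lies in the cone at \<open>v\<close> spanned by the directions to
  \<open>u\<close> and \<open>w\<close>, neither of which descends. So \<open>v\<close> is the
  rightmost lowest point, and only one corner can have this sign pattern; this yields the single
  turn of the frame.\<close>

lemma lowest_corner: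
  assumes "interior N \<noteq> {}" "(u, v) \<in> sides N" "(v, w) \<in> sides N"
    and "Im v \<le> Im u" "Im v < Im w" and z: "z \<in> N"
  shows "Im v < Im z \<or> Im z = Im v \<and> Re z \<le> Re v"
proof -
  define a b y where "a = v - u" and "b = w - v" and "y = z - v"
  have ab: "0 < cross a b"
    using side_turn assms by (simp add: a_def b_def)
  have "0 \<le> cross b y"
    using sideD(4) [OF assms(3) z] by (simp add: b_def y_def)
  moreover have "0 \<le> cross a y"
    using sideD(4) [OF assms(2) z] by (simp add: a_def y_def cross_eq algebra_simps)
  moreover have Im_ab: "Im a \<le> 0" "0 < Im b"
    using assms by (auto simp: a_def b_def)
  \<comment> \<open>Cramer's rule for \<open>y\<close> in terms of the two side vectors
    \<open>a\<close> and \<open>b\<close>.\<close>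
  moreover have Im: "cross a b * Im y = cross a y * Im b + cross b y * (- Im a)"
    and Re: "cross a b * Re y = cross a y * Re b - cross b y * Re a"
    by (simp_all add: cross_eq algebra_simps)
  ultimately have nn: "0 \<le> cross a y * Im b" "0 \<le> cross b y * (- Im a)"
    by (auto intro: mult_nonneg_nonneg mult_nonneg_nonpos)
  then have "0 \<le> cross a b * Im y"
    unfolding Im by linarith
  then have "0 \<le> Im y"
    using ab by (simp add: zero_le_mult_iff)
  moreover have "Re y \<le> 0" if "Im y = 0"
  proof -
    have "cross a y * Im b = 0" and ba: "cross b y * Im a = 0"
      using Im nn that by auto
    then have ay: "cross a y = 0"
      using Im_ab by simp
    have "0 \<le> cross b y * Re a"
    proof (cases "Im a = 0")
      case True
      then have "0 < Re a"
        using ab Im_ab by (simp add: cross_eq zero_less_mult_iff)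
      then show ?thesis
        using \<open>0 \<le> cross b y\<close> by simp
    qed (use ba in auto)
    then have "cross a b * Re y \<le> 0"
      using Re ay by simp
    then show ?thesis
      using ab by (simp add: mult_le_0_iff)
  qed
  ultimately show ?thesis
    by (auto simp: y_def)
qed

lemma corners_lattice:
  assumes "convex_lattice_polygon N" "v \<in> corners N"
  shows "v \<in> lattice"
  using assms extreme_point_of_convex_hull
  by (auto simp: convex_lattice_polygon_def corners_def)

text \<open>The length is a divisor in \<open>primitive\<close> and in the coefficients
  \<open>c\<close>. It vanishes only if the side has exactly one lattice point, but its two ends are
  distinct lattice points.\<close>

lemma lattice_length_nonzero:
  assumes "convex_lattice_polygon N" "(u, w) \<in> sides N"
  shows "lattice_length (u, w) \<noteq> 0"
proof
  assume "lattice_length (u, w) = 0"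
  then have "card (closed_segment u w \<inter> lattice) = 1"
    by (simp add: lattice_length_def)
  moreover have "u \<in> closed_segment u w \<inter> lattice" "w \<in> closed_segment u w \<inter> lattice"
    using corners_lattice assms side_corners by auto
  ultimately show False
    using sideD(1) [OF assms(2)] by (metis card_1_singletonE singletonD)
qed

section \<open>The astroidal domain\<close>

lemma clockwise_corners_map_upt:
  assumes "W n = W 0" "inj_on W {..<n}" "W ` {..<n} = corners N"
    and "\<And>i. i < n \<Longrightarrow> (W (Suc i), W i) \<in> sides N"
  shows "clockwise_corners N (map W [0..<n])"
proof -
  have "W (Suc i mod n) = W (Suc i)" if "i < n" for i
    using that assms(1) by (cases "Suc i = n") auto
  then show ?thesis
    using assms(2-4) by (auto simp: clockwise_corners_def distinct_map atLeast0LessThan)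
qed

lemma Suc_mod_cancel: "Suc i mod n = Suc j mod n \<Longrightarrow> i mod n = (j :: nat) mod n"
  by (auto simp: mod_Suc split: if_splits)

text \<open>Both endpoints of a side are neighbours along the polygon, and no side of \<open>N\<close> occurs with
  both orientations; so if one side advances along the list \<open>ps\<close>, all of them do.\<close>

lemma clockwise_enumeration:
  assumes N: "convex_lattice_polygon N" and ps: "simple_polygon ps"
    and bij: "bij_betw p (corners N) (set ps)" and ord: "order_preserving N ps p"
  obtains vs where "clockwise_corners N vs" "simple_polygon (map p vs)"
    "boundary (map p vs) = boundary ps"
proof -
  define n where "n = length ps"
  have int: "interior N \<noteq> {}"
    using N by (simp add: convex_lattice_polygon_def)
  have n: "n \<ge> 3" and dist: "distinct ps"
    using ps simple_polygon_distinct by (auto simp: simple_polygon_def n_def)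
  \<comment> \<open>Reading the corners along \<open>ps\<close> with a periodic index removes the
    special case of the closing edge.\<close>
  define V where "V i = the_inv_into (corners N) p (ps ! (i mod n))" for i
  have inj: "inj_on p (corners N)" and img: "p ` corners N = set ps"
    using bij by (auto simp: bij_betw_def)
  have in_ps: "ps ! (i mod n) \<in> set ps" for i
    using n unfolding n_def by (intro nth_mem mod_less_divisor) linarith
  have V: "V i \<in> corners N" and pV: "p (V i) = ps ! (i mod n)" for i
    unfolding V_def using in_ps img inj
    by (auto intro: the_inv_into_into f_the_inv_into_f)
  have VI: "v = V i" if "v \<in> corners N" "p v = ps ! (i mod n)" for v i
    using that V pV inj by (metis inj_onD)
  have V_mod: "V i = V j" if "i mod n = j mod n" for i j
    unfolding V_def that ..
  have V_inj: "i mod n = j mod n" if "V i = V j" for i j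
    using that pV dist n by (metis gr_zeroI mod_less_divisor n_def nth_eq_iff_index_eq not_numeral_le_zero)
  have V_img: "v \<in> V ` {..<n}" if "v \<in> corners N" for v
  proof -
    have "p v \<in> set ps"
      using that img by blast
    then obtain i where "i < n" "p v = ps ! i"
      unfolding n_def in_set_conv_nth by metis
    then show ?thesis
      using VI [OF that, of i] by auto
  qed
  define fwd bwd where "fwd i \<longleftrightarrow> (V i, V (Suc i)) \<in> sides N"
    and "bwd i \<longleftrightarrow> (V (Suc i), V i) \<in> sides N" for i
  \<comment> \<open>The side leaving \<open>V i\<close> ends at a neighbour along \<open>ps\<close>,
    which is either the next or the previous position.\<close>
  have alt: "fwd i \<or> (\<exists>j. i mod n = Suc j mod n \<and> bwd j)" for i
  proof -
    obtain w where w: "(V i, w) \<in> sides N"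
      using side_from_exists N V by blast
    then have wc: "w \<in> corners N"
      by (rule side_corners)
    have "consecutive ps (p (V i)) (p w)"
      using ord w unfolding order_preserving_def by blast
    then obtain j where j: "j < n" "{ps ! (i mod n), p w} = {ps ! j, ps ! (Suc j mod n)}"
      unfolding consecutive_def pV n_def by blast
    then consider "ps ! (i mod n) = ps ! j" "p w = ps ! (Suc j mod n)"
      | "ps ! (i mod n) = ps ! (Suc j mod n)" "p w = ps ! j"
      by (metis doubleton_eq_iff)
    then show ?thesis
    proof cases
      case 1
      then have "V i = V j"
        using VI [OF V, of i j] pV j(1) by simp
      then have "Suc i mod n = Suc j mod n"
        by (metis V_inj mod_Suc_eq)
      then have "w = V (Suc i)"
        using VI [OF wc, of "Suc i"] 1 by simp
      then show ?thesis
        using w by (simp add: fwd_def)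
    next
      case 2
      then have eq: "V i = V (Suc j)"
        using VI [OF V, of i "Suc j"] pV [of i] by simp
      moreover have "w = V j"
        using VI [OF wc, of j] 2 j(1) by simp
      ultimately have "bwd j"
        using w by (simp add: bwd_def)
      then show ?thesis
        using V_inj [OF eq] by blast
    qed
  qed
  have bwd_mod: "bwd i" if "bwd j" "Suc i mod n = Suc j mod n" for i j
  proof -
    have "V i = V j" "V (Suc i) = V (Suc j)"
      using V_mod that(2) Suc_mod_cancel by blast+
    then show ?thesis
      using that(1) by (simp add: bwd_def)
  qed
  have fwd_Suc: "fwd (Suc i)" if "fwd i" for i
  proof (rule ccontr)
    assume "\<not> fwd (Suc i)"
    then have "bwd i"
      using alt bwd_mod by blast
    then show False
      using that sides_antisym [OF int] by (simp add: fwd_def bwd_def)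
  qed
  show thesis
  proof (cases "\<exists>i. fwd i")
    case True
    then obtain i where "fwd i" ..
    then have fwd_add: "fwd (i + k)" for k
      by (induction k) (auto intro: fwd_Suc)
    have all: "(V m, V (Suc m)) \<in> sides N" for m
    proof -
      \<comment> \<open>Forward steps propagate only upwards from \<open>i\<close>, so
        \<open>m\<close> is replaced by a congruent index that is at least \<open>i\<close>.\<close>
      have "i \<le> m + i * n"
        using n by (simp add: trans_le_add2)
      then have "fwd (m + i * n)"
        using fwd_add [of "m + i * n - i"] by simp
      moreover have "V (m + i * n) = V m" "V (Suc (m + i * n)) = V (Suc m)"
        by (rule V_mod, simp, rule V_mod) (metis add_Suc mod_mult_self1)
      ultimately show ?thesis
        by (simp add: fwd_def)
    qed
    \<comment> \<open>Here \<open>ps\<close> runs counterclockwise with respect to \<open>N\<close>,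
      so it is read backwards. Index 0 gives \<open>V n = V 0\<close>, which keeps the first vertex
      in place.\<close>
    let ?vs = "map (\<lambda>i. V (n - i)) [0..<n]"
    obtain a qs where aqs: "ps = a # qs"
      using n by (cases ps) (auto simp: n_def)
    have "map p ?vs = a # rev qs"
    proof (rule nth_equalityI)
      fix k assume "k < length (map p ?vs)"
      then have k: "k < n" by simp
      have "map p ?vs ! k = (a # qs) ! ((n - k) mod n)"
        using k nth_map_upt [of k n 0 "\<lambda>i. p (V (n - i))"] by (simp add: o_def pV aqs del: upt_Suc)
      then show "map p ?vs ! k = (a # rev qs) ! k"
        using k by (cases k) (auto simp: aqs n_def rev_nth)
    qed (simp add: n_def aqs)
    moreover have "clockwise_corners N ?vs"
    proof (rule clockwise_corners_map_upt)
      show "V (n - n) = V (n - 0)"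
        by (rule V_mod) simp
      show "inj_on (\<lambda>i. V (n - i)) {..<n}"
      proof (rule inj_onI)
        fix x y assume xy: "x \<in> {..<n}" "y \<in> {..<n}" "V (n - x) = V (n - y)"
        from V_inj [OF xy(3)] xy(1,2) show "x = y"
          by (cases "x = 0"; cases "y = 0") auto
      qed
      show "(\<lambda>i. V (n - i)) ` {..<n} = corners N"
      proof
        show "corners N \<subseteq> (\<lambda>i. V (n - i)) ` {..<n}"
        proof
          fix v assume "v \<in> corners N"
          then obtain k where k: "k < n" "v = V k"
            using V_img by blast
          \<comment> \<open>The \<open>mod\<close> sends \<open>k = 0\<close> to index 0 rather than
            \<open>n\<close>, which is out of range.\<close>
          then have "v = V (n - (n - k) mod n)"
            by (cases "k = 0") (simp_all add: V_mod [of n 0])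
          moreover have "(n - k) mod n < n"
            using n by simp
          ultimately show "v \<in> (\<lambda>i. V (n - i)) ` {..<n}"
            by blast
        qed
      qed (use V in auto)
      show "(V (n - Suc k), V (n - k)) \<in> sides N" if "k < n" for k
        using all [of "n - Suc k"] that by (simp add: Suc_diff_Suc)
    qed
    ultimately show thesis
      using that [of ?vs] simple_polygon_rev [of a qs] boundary_rev [of a qs] ps aqs by simp
  next
    case False
    have all: "(V (Suc m), V m) \<in> sides N" for m
      using alt [of "Suc m"] False bwd_mod by (auto simp: bwd_def)
    let ?vs = "map V [0..<n]"
    have "map p ?vs = ps"
      by (rule nth_equalityI) (auto simp: pV n_def)
    moreover have "clockwise_corners N ?vs"
    proof (rule clockwise_corners_map_upt)
      show "inj_on V {..<n}"
        by (rule inj_onI) (metis V_inj lessThan_iff mod_less)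
      show "V ` {..<n} = corners N"
        using V V_img by blast
    qed (use all V_mod [of n 0] in simp_all)
    ultimately show thesis
      using that [of ?vs] ps by simp
  qed
qed

section \<open>Vertices, admissibility and orientation\<close>

text \<open>By \<open>lines\<close>, the point \<open>p v\<close> is on the lines of both sides at
  \<open>v\<close>. These sides have independent directions, so the lines meet nowhere else.\<close>

lemma astroidal_vertex_eq:
  assumes N: "convex_lattice_polygon N" and v: "v \<in> corners N"
    and lines: "\<And>u w. (u, w) \<in> sides N \<Longrightarrow>
      cross (w - u) (p u) = d u - d w \<and> cross (w - u) (p w) = d u - (d w :: real)"
  shows "astroidal_vertex N (\<lambda>(u, w). (d w - d u) / lattice_length (u, w)) v = p v"
proof -
  let ?c = "\<lambda>(u, w). (d w - d u) / lattice_length (u, w)"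
  have side_line: "z \<in> side_line ?c (u, w) \<longleftrightarrow> cross (w - u) z = d u - d w"
    if "(u, w) \<in> sides N" for u w z
  proof -
    let ?L = "lattice_length (u, w)"
    have L: "?L \<noteq> 0"
      using lattice_length_nonzero N that by blast
    have "- Im (primitive (u, w)) * Re z + Re (primitive (u, w)) * Im z + ?c (u, w)
        = (cross (w - u) z - (d u - d w)) / ?L"
      by (simp add: primitive_def cross_eq diff_divide_distrib add_divide_distrib algebra_simps)
    then show ?thesis
      using L by (simp add: side_line_def)
  qed
  obtain u w where uv: "(u, v) \<in> sides N" and vw: "(v, w) \<in> sides N"
    using side_to_exists side_from_exists N v by metis
  have "side_before N v = (u, v)"
    unfolding side_before_def using uv side_to_unique by (intro the_equality) auto
  moreover have "side_after N v = (v, w)"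
    unfolding side_after_def using vw side_from_unique by (intro the_equality) auto
  moreover have "side_line ?c (u, v) \<inter> side_line ?c (v, w) = {p v}"
  proof -
    have "z = p v" if "z \<in> side_line ?c (u, v)" "z \<in> side_line ?c (v, w)" for z
    proof -
      let ?a = "v - u" and ?b = "w - v" and ?y = "z - p v"
      have "cross ?a z = cross ?a (p v)" "cross ?b z = cross ?b (p v)"
        using that side_line [OF uv] side_line [OF vw] lines [OF uv] lines [OF vw] by simp_all
      then have ay: "cross ?a ?y = 0" and b_y: "cross ?b ?y = 0"
        by (simp_all add: cross_eq algebra_simps)
      have "0 < cross ?a ?b"
        using side_turn [OF _ uv vw] N by (simp add: convex_lattice_polygon_def)
      moreover have "cross ?a ?b * Re ?y = cross ?a ?y * Re ?b - cross ?b ?y * Re ?a"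
        "cross ?a ?b * Im ?y = cross ?a ?y * Im ?b - cross ?b ?y * Im ?a"
        by (simp_all add: cross_eq algebra_simps)
      ultimately have "Re ?y = 0" "Im ?y = 0"
        unfolding ay b_y by simp_all
      then show ?thesis
        by (simp add: complex_eq_iff)
    qed
    moreover have "p v \<in> side_line ?c (u, v)" "p v \<in> side_line ?c (v, w)"
      using side_line uv vw lines by blast+
    ultimately show ?thesis
      by blast
  qed
  ultimately show ?thesis
    by (simp add: astroidal_vertex_def)
qed

text \<open>Every corner is the start of exactly one side and the end of exactly one side, so the
  sums of \<open>d\<close> over starts and over ends agree.\<close>

lemma admissible_difference:
  assumes "convex_lattice_polygon N"
  shows "admissible N (\<lambda>(u, w). (d w - d u) / lattice_length (u, w))"
proof -
  have "fst ` sides N = corners N"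
  proof
    show "corners N \<subseteq> fst ` sides N"
      using side_from_exists [OF assms] by (metis fst_conv imageI subsetI)
  qed (use side_corners(1) in auto)
  moreover have "inj_on fst (sides N)"
    by (rule inj_onI) (metis prod.collapse side_from_unique)
  ultimately have "(\<Sum>e\<in>sides N. d (fst e)) = sum d (corners N)"
    using sum.reindex [of fst "sides N" d] by (simp add: o_def)
  moreover have "snd ` sides N = corners N"
  proof
    show "corners N \<subseteq> snd ` sides N"
      using side_to_exists [OF assms] by (metis snd_conv imageI subsetI)
  qed (use side_corners(2) in auto)
  moreover have "inj_on snd (sides N)"
    by (rule inj_onI) (metis prod.collapse side_to_unique)
  ultimately have eq: "(\<Sum>e\<in>sides N. d (fst e)) = (\<Sum>e\<in>sides N. d (snd e))"
    using sum.reindex [of snd "sides N" d] by (simp add: o_def)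
  have "lattice_length e * (case e of (u, w) \<Rightarrow> (d w - d u) / lattice_length (u, w)) = d (snd e) - d (fst e)"
    if "e \<in> sides N" for e
    using lattice_length_nonzero [OF assms, of "fst e" "snd e"] that by (simp add: case_prod_beta)
  then have "(\<Sum>e\<in>sides N. lattice_length e * (case e of (u, w) \<Rightarrow> (d w - d u) / lattice_length (u, w)))
      = (\<Sum>e\<in>sides N. d (snd e) - d (fst e))"
    by (intro sum.cong refl)
  also have "\<dots> = 0"
    unfolding sum_subtractf eq by simp
  finally show ?thesis
    unfolding admissible_def .
qed

text \<open>The rotating-frame estimate applies with \<open>F\<close> the side vectors of
  \<open>N\<close> taken clockwise and \<open>Q\<close> the polygon seen from \<open>z\<close>;
  \<open>lines\<close> makes each edge parallel to its side.\<close>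

lemma Re_winding_number_nonneg:
  assumes N: "convex_lattice_polygon N" and vs: "clockwise_corners N vs" "length vs \<ge> 3"
    and lines: "\<And>u w. (u, w) \<in> sides N \<Longrightarrow>
      cross (w - u) (p u) = d u - d w \<and> cross (w - u) (p w) = d u - (d w :: real)"
    and z: "z \<notin> boundary (map p vs)"
  shows "0 \<le> Re (winding_number (closed_polygon (map p vs)) z)"
proof -
  define n where "n = length vs"
  have n: "n \<ge> 3"
    using vs n_def by simp
  have int: "interior N \<noteq> {}"
    using N by (simp add: convex_lattice_polygon_def)
  define V where "V i = vs ! (i mod n)" for i
  define Q where "Q i = p (V i) - z" for i
  define F where "F i = V (Suc i) - V i" for i
  have side: "(V (Suc i), V i) \<in> sides N" for i
  proof -
    have "i mod n < n"
      using n by simp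
    then have "(vs ! (Suc (i mod n) mod n), vs ! (i mod n)) \<in> sides N"
      using vs(1) by (simp add: clockwise_corners_def n_def)
    then show ?thesis
      by (simp add: V_def mod_Suc_eq)
  qed
  let ?qs = "map p vs @ [hd (map p vs)]"
  have nth: "?qs ! i = p (V i)" if "i \<le> n" for i
  proof (cases "i = n")
    case True
    have "vs \<noteq> []"
      using n by (auto simp: n_def)
    then show ?thesis
      using True by (simp add: nth_append n_def V_def hd_map hd_conv_nth)
  next
    case False
    then show ?thesis
      using that by (simp add: nth_append n_def V_def)
  qed
  have len: "length ?qs = Suc n"
    by (simp add: n_def)
  have image: "z \<notin> path_image (polygonal_path ?qs)"
    using z by (simp add: boundary_def closed_polygon_def)
  have seg: "z \<notin> closed_segment (p (V i)) (p (V (Suc i)))" if "i < n" for i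
    using segment_subset_path_image_polygonal_path [of i ?qs] image that nth [of i] nth [of "Suc i"] len
    by auto
  \<comment> \<open>The sides follow one another in the order opposite to \<open>vs\<close>, so the
    left turn of \<open>N\<close> appears as a turn from \<open>F (Suc i)\<close> to
    \<open>F i\<close>.\<close>
  have turn: "0 < Im (F i / F (Suc i))" for i
  proof -
    have "0 < cross (V (Suc i) - V (Suc (Suc i))) (V i - V (Suc i))"
      using side_turn [OF int side side] .
    then have "0 < cross (F (Suc i)) (F i)"
      by (simp add: F_def cross_eq algebra_simps)
    then have "F (Suc i) \<noteq> 0" "0 < Im (F i) * Re (F (Suc i)) - Re (F i) * Im (F (Suc i))"
      by (auto simp: cross_eq algebra_simps)
    then show ?thesis
      by (simp add: Im_divide sum_power2_gt_zero_iff complex_eq_iff)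
  qed
  have V_per: "V n = V 0" "V (Suc n) = V (Suc 0)"
    using n by (simp_all add: V_def mod_Suc)
  have line: "cross (F i) (p (V i)) = d (V i) - d (V (Suc i))"
      "cross (F i) (p (V (Suc i))) = d (V i) - d (V (Suc i))" for i
    using lines [OF side [of i]] by (auto simp: F_def cross_eq algebra_simps)
  have "0 \<le> (\<Sum>i<n. Arg (Q (Suc i) / Q i))"
  proof (rule sum_Arg_nonneg_of_rotating_frame)
    show "Q n = Q 0" "F n = F 0" "n > 0"
      using V_per n by (auto simp: Q_def F_def)
    show "Im (cnj (F i) * Q (Suc i)) = Im (cnj (F i) * Q i)" if "i < n" for i
      using line [of i] unfolding cross_def [symmetric] Q_def by (simp add: cross_eq algebra_simps)
    show "Q i \<noteq> 0" if "i \<le> n" for i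
    proof -
      have "?qs ! i \<in> path_image (polygonal_path ?qs)"
        using set_subset_path_image_polygonal_path len that nth_mem by (metis le_imp_less_Suc subsetD)
      then show ?thesis
        using image nth [OF that] by (auto simp: Q_def)
    qed
    show "Q (Suc i) / Q i \<notin> \<real>\<^sub>\<le>\<^sub>0" if "i < n" for i
      unfolding Q_def using seg [OF that] by (rule Re_winding_number_linepath)
    show "0 < Im (F i / F (Suc i))" for i
      by (rule turn)
    show "(\<Sum>i<n. Arg (F i / F (Suc i))) = 2 * pi"
    proof (rule sum_Arg_cw_eq_2pi)
      show "F n = F 0" "n > 0"
        using V_per n by (auto simp: F_def)
      show "0 < Im (F i / F (Suc i))" for i
        by (rule turn)
      fix i j assume ij: "i < n" "j < n" and "0 \<le> Im (F (Suc i))" "Im (F i) < 0"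
        "0 \<le> Im (F (Suc j))" "Im (F j) < 0"
      \<comment> \<open>Two crossings would give two rightmost lowest corners, which must
        coincide.\<close>
      then have low: "Im (V (Suc i)) < Im x \<or> Im x = Im (V (Suc i)) \<and> Re x \<le> Re (V (Suc i))"
          "Im (V (Suc j)) < Im x \<or> Im x = Im (V (Suc j)) \<and> Re x \<le> Re (V (Suc j))" if "x \<in> N" for x
        using lowest_corner [OF int side side _ _ that] by (auto simp: F_def)
      have "V (Suc k) \<in> N" for k
        using side_corners side by blast
      then have "V (Suc i) = V (Suc j)"
        using low(1) [of "V (Suc j)"] low(2) [of "V (Suc i)"] by (simp add: complex_eq_iff) argo
      moreover have "distinct vs"
        using vs(1) by (simp add: clockwise_corners_def)
      moreover have "Suc k mod n < length vs" for k
        unfolding n_def [symmetric] using n by (intro mod_less_divisor) linarith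
      ultimately have "Suc i mod n = Suc j mod n"
        by (simp only: V_def nth_eq_iff_index_eq)
      then show "i = j"
        using Suc_mod_cancel [of i n j] ij by simp
    qed
    \<comment> \<open>\<open>H\<close> is \<open>d\<close> adjusted for moving the origin to
      \<open>z\<close>. The adjusted differences still telescope, which is the translation
      invariance of admissibility.\<close>
    define H where "H i = d (V i) + cross (V i) z" for i
    have "Im (cnj (F i) * Q i) = H i - H (Suc i)" for i
      using line [of i] unfolding cross_def [symmetric] Q_def H_def
      by (simp add: F_def cross_eq algebra_simps)
    then have "(\<Sum>i<n. Im (cnj (F i) * Q i)) = (\<Sum>i<n. H i - H (Suc i))"
      by (rule sum.cong [OF refl])
    also have "\<dots> = 0"
      unfolding sum_lessThan_telescope' using V_per by (simp add: H_def)
    finally show "(\<Sum>i<n. Im (cnj (F i) * Q i)) = 0" .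
  qed
  also have "\<dots> = (\<Sum>i<length ?qs - 1. Arg ((?qs ! Suc i - z) / (?qs ! i - z)))"
    unfolding len by (intro sum.cong) (simp_all add: Q_def nth del: append.simps)
  finally show ?thesis
    unfolding closed_polygon_def using image
    by (subst Re_winding_number_polygonal_path) auto
qed

theorem proposition5p4:
  fixes N :: "complex set" and \<tau> :: complex and ps :: "complex list"
    and p :: "complex \<Rightarrow> complex" and h\<^sub>0 :: "complex \<Rightarrow> real" and d :: "complex \<Rightarrow> real"
  assumes "convex_lattice_polygon N"
    and "simple_polygon ps"
    and "bij_betw p (corners N) (set ps)"
    and "order_preserving N ps p"
    and "continuous_on (boundary ps) h\<^sub>0"
    and "piecewise_linear_on (boundary ps) h\<^sub>0"
    and "\<And>v q z. \<lbrakk>v \<in> corners N; consecutive ps (p v) q; z \<in> closed_segment (p v) q\<rbrakk>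
           \<Longrightarrow> h\<^sub>0 z = z \<bullet> dual_vertex \<tau> v - d v"
  shows "astroidal_domain N (\<lambda>(u, w). (d w - d u) / lattice_length (u, w)) (enclosed_region ps)"
proof -
  let ?c = "\<lambda>(u, w). (d w - d u) / lattice_length (u, w)"
  have lines: "cross (w - u) (p u) = d u - d w \<and> cross (w - u) (p w) = d u - d w"
    if side: "(u, w) \<in> sides N" for u w
  proof -
    have "consecutive ps (p u) (p w)"
      using assms(4) side unfolding order_preserving_def by blast
    moreover then have "consecutive ps (p w) (p u)"
      by (simp add: consecutive_def insert_commute)
    ultimately have eq: "z \<bullet> dual_vertex \<tau> u - d u = z \<bullet> dual_vertex \<tau> w - d w"
      if "z \<in> closed_segment (p u) (p w)" for z
      using assms(7) [of u "p w" z] assms(7) [of w "p u" z] side_corners [OF side] that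
      by (simp add: closed_segment_commute)
    \<comment> \<open>In the difference of the two affine formulas \<open>\<tau>\<close> cancels,
      and the quarter turn in \<open>dual_vertex\<close> turns the inner product into a
      determinant.\<close>
    have "cross (w - u) z = d u - d w" if "z \<in> closed_segment (p u) (p w)" for z
      using eq [OF that] by (simp add: dual_vertex_def inner_complex_def cross_eq algebra_simps)
    then show ?thesis
      by simp
  qed
  obtain vs where vs: "clockwise_corners N vs" "simple_polygon (map p vs)"
      "boundary (map p vs) = boundary ps"
    using clockwise_enumeration assms(1-4) by blast
  have "length vs \<ge> 3" and simple: "simple_path (closed_polygon (map p vs))"
    using vs(2) by (simp_all add: simple_polygon_def)
  have map: "map p vs = map (astroidal_vertex N ?c) vs"
  proof (rule map_cong [OF refl])
    fix v assume "v \<in> set vs"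
    then have "v \<in> corners N"
      using vs(1) by (simp add: clockwise_corners_def)
    then show "p v = astroidal_vertex N ?c v"
      using astroidal_vertex_eq [OF assms(1) _ lines] by simp
  qed
  have winding: "winding_number (closed_polygon (map p vs)) z = 1"
    if z: "z \<in> inside (boundary (map p vs))" for z
  proof -
    have notin: "z \<notin> boundary (map p vs)"
      using z inside_no_overlap by blast
    have nonneg: "0 \<le> Re (winding_number (closed_polygon (map p vs)) z)"
      using Re_winding_number_nonneg [OF assms(1) vs(1) \<open>length vs \<ge> 3\<close> lines notin] .
    \<comment> \<open>The winding number of a simple loop is 1 at all inside points or -1 at all of
      them; the sign of its real part excludes the latter.\<close>
    show ?thesis
    proof (rule simple_closed_path_winding_number_inside [OF simple])
      assume "\<And>z. z \<in> inside (path_image (closed_polygon (map p vs)))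
        \<Longrightarrow> winding_number (closed_polygon (map p vs)) z = - 1"
      then have "winding_number (closed_polygon (map p vs)) z = - 1"
        using z by (simp add: boundary_def)
      with nonneg show ?thesis by simp
    qed (use z in \<open>simp add: boundary_def\<close>)
  qed
  have "enclosed_region ps = enclosed_region (map p vs)"
    by (simp add: enclosed_region_def vs(3))
  then show ?thesis
    unfolding astroidal_domain_def
    using admissible_difference [OF assms(1), of d] vs(1,2) map winding by blast
qed

end
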